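(* For every Eulerian binary matroid $M \subseteq \mathbb{F}_2^n \setminus \{0\}$, $$c_2(M) \le \frac{4}{3}\, a(M) \qquad \text{and} \qquad c_2(M) = (1 + o(1))\, a(M) \quad \text{as } a(M) \to \infty.$$ The second statement means: for every $\varepsilon > 0$ there exists $a_0$ such that for every $n \ge 1$ and every Eulerian binary matroid $M \subseteq \mathbb{F}_2^n \setminus \{0\}$ with $a(M) \ge a_0$, $(1-\varepsilon)\, a(M) \le c_2(M) \le (1+\varepsilon)\, a(M)$.
   Context: A (simple) binary matroid is a subset $M \subseteq \mathbb{F}_2^n \setminus \{0\}$ for some $n \ge 1$. $M$ is Eulerian if $\sum_{x \in M} x = 0$ in $\mathbb{F}_2^n$. A circuit in $\mathbb{F}_2^n$ is a minimal (with respect to inclusion) non-empty Eulerian subset of $\mathbb{F}_2^n \setminus \{0\}$. A circuit odd-cover of $M$ is a collection of circuits $C_1, \dots, C_t \subseteq \mathbb{F}_2^n$ (not necessarily contained in $M$) such that $C_1 \oplus \dots \oplus C_t = M$, where $\oplus$ denotes symmetric difference of sets; one exists if and only if $M$ is Eulerian. For Eulerian $M$, $c_2(M)$ denotes the minimum number of circuits in a circuit odd-cover of $M$. The arboricity $a(M)$ is the minimum $t$ such that $M$ can be expressed as the union of $t$ linearly independent (over $\mathbb{F}_2$) sets. *)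

theory Defs
  imports Complex_Main "HOL-Library.Z2" "HOL-Library.Function_Algebras"
begin

text \<open>
  The dimension \<open>n\<close> is quantified inside the theorem, so \<open>\<bbbF>\<^sub>2\<^sup>n\<close> is a set rather than a type:
  the functions \<open>nat \<Rightarrow> bit\<close> that vanish outside \<open>{..<n}\<close>, with pointwise addition.
\<close>

definition F2_space :: "nat \<Rightarrow> (nat \<Rightarrow> bit) set" where
  "F2_space n = {x. \<forall>i\<ge>n. x i = 0}"

definition F2_scale :: "bit \<Rightarrow> (nat \<Rightarrow> bit) \<Rightarrow> (nat \<Rightarrow> bit)" where
  "F2_scale c x = (\<lambda>i. c * x i)"

global_interpretation F2: vector_space F2_scale
  by unfold_locales (auto simp: F2_scale_def fun_eq_iff algebra_simps)

definition binary_matroid :: "nat \<Rightarrow> (nat \<Rightarrow> bit) set \<Rightarrow> bool" where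
  "binary_matroid n M \<longleftrightarrow> n \<ge> 1 \<and> M \<subseteq> F2_space n - {0}"

text \<open>
  On an infinite set the sum is \<open>0\<close> by convention; below, \<open>eulerian\<close> is only applied to subsets
  of the finite set \<open>F2_space n\<close> (see \<open>finite_F2_space\<close>).
\<close>

definition eulerian :: "(nat \<Rightarrow> bit) set \<Rightarrow> bool" where
  "eulerian M \<longleftrightarrow> (\<Sum>x\<in>M. x) = 0"

definition circuit :: "nat \<Rightarrow> (nat \<Rightarrow> bit) set \<Rightarrow> bool" where
  "circuit n C \<longleftrightarrow> C \<subseteq> F2_space n - {0} \<and> C \<noteq> {} \<and> eulerian C \<and>
     (\<forall>D. D \<subseteq> C \<longrightarrow> D \<noteq> {} \<longrightarrow> eulerian D \<longrightarrow> D = C)"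

definition circuit_odd_cover ::
    "nat \<Rightarrow> (nat \<Rightarrow> bit) set \<Rightarrow> (nat \<Rightarrow> bit) set list \<Rightarrow> bool" where
  "circuit_odd_cover n M Cs \<longleftrightarrow> (\<forall>C\<in>set Cs. circuit n C) \<and> foldr sym_diff Cs {} = M"

text \<open>
  The two minima below are attained whenever \<open>M\<close> is an Eulerian binary matroid, respectively a
  binary matroid: see \<open>ex_circuit_odd_cover\<close> and \<open>ex_independent_cover\<close>.
\<close>

definition c2 :: "nat \<Rightarrow> (nat \<Rightarrow> bit) set \<Rightarrow> nat" where
  "c2 n M = (LEAST t. \<exists>Cs. length Cs = t \<and> circuit_odd_cover n M Cs)"

definition arboricity :: "(nat \<Rightarrow> bit) set \<Rightarrow> nat" where
  "arboricity M =
     (LEAST t. \<exists>Is. length Is = t \<and> (\<forall>I\<in>set Is. F2.independent I) \<and> \<Union>(set Is) = M)"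

lemma finite_F2_space: "finite (F2_space n)"
proof -
  have "F2_space n \<subseteq> (\<lambda>A i. if i \<in> A then 1 else 0) ` Pow {..<n}"
  proof
    fix x assume x: "x \<in> F2_space n"
    have "x i = (if i \<in> {i. x i = 1} then 1 else 0)" for i
      by (cases "x i") auto
    then have "x = (\<lambda>i. if i \<in> {i. x i = 1} then 1 else 0)"
      by blast
    moreover have "{i. x i = 1} \<subseteq> {..<n}"
      using x unfolding F2_space_def by (metis (mono_tags) lessThan_iff mem_Collect_eq
          not_le subsetI zero_neq_one)
    ultimately show "x \<in> (\<lambda>A i. if i \<in> A then 1 else 0) ` Pow {..<n}"
      by (rule image_eqI[OF _ PowI])
  qed
  then show ?thesis
    by (rule finite_subset) simp
qed

lemma ex_circuit_odd_cover:
  assumes "M \<subseteq> F2_space n - {0}" "eulerian M"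
  shows "\<exists>Cs. circuit_odd_cover n M Cs"
proof -
  have "finite M"
    using assms(1) finite_F2_space by (meson Diff_subset finite_subset)
  then show ?thesis
    using assms
  proof (induction M rule: finite_psubset_induct)
    case (psubset M)
    show ?case
    proof (cases "M = {}")
      case True
      then show ?thesis
        by (intro exI[of _ "[]"]) (simp add: circuit_odd_cover_def)
    next
      case False
      let ?S = "{D. D \<subseteq> M \<and> D \<noteq> {} \<and> eulerian D}"
      have "finite ?S" "M \<in> ?S"
        using psubset False by auto
      then obtain C where C: "C \<in> ?S" and min: "\<And>D. D \<in> ?S \<Longrightarrow> D \<subseteq> C \<Longrightarrow> D = C"
        by (metis (no_types, lifting) finite_has_minimal2)
      have "circuit n C"
        unfolding circuit_def using C min psubset.prems by blast
      have "sum id M = sum id (M - C) + sum id C"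
        using C psubset.hyps by (intro sum.subset_diff) auto
      then have "eulerian (M - C)"
        using C psubset.prems by (simp add: eulerian_def)
      moreover have "M - C \<subset> M" "M - C \<subseteq> F2_space n - {0}"
        using C psubset.prems by blast+
      ultimately obtain Cs where "circuit_odd_cover n (M - C) Cs"
        using psubset.IH by blast
      then have "circuit_odd_cover n M (C # Cs)"
        using C \<open>circuit n C\<close> by (auto simp: circuit_odd_cover_def)
      then show ?thesis ..
    qed
  qed
qed

lemma ex_independent_cover:
  assumes "M \<subseteq> F2_space n - {0}"
  shows "\<exists>Is. (\<forall>I\<in>set Is. F2.independent I) \<and> \<Union>(set Is) = M"
proof -
  have "finite M"
    using assms finite_F2_space by (meson Diff_subset finite_subset)
  then obtain xs where "set xs = M"
    using finite_list by blast
  then have "(\<forall>I\<in>set (map (\<lambda>x. {x}) xs). F2.independent I) \<and> \<Union>(set (map (\<lambda>x. {x}) xs)) = M"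
    using assms by auto
  then show ?thesis
    by blast
qed

end

theory Submission
  imports Defs
begin

text \<open>
  A circuit is an independent set \<open>I\<close> with at least two elements together with the one further
  vector \<open>\<Sum>I\<close>. So an independent set and a circuit differ by a single vector, and \<open>c2\<close> and
  \<open>arboricity\<close> differ by no more than it costs to handle these surplus vectors, of which there
  is one for each circuit.

  For the upper bounds, partition \<open>M\<close> into \<open>a\<close> independent sets and close each of them to a
  circuit by adding its sum; a single vector is its own sum and needs no circuit. The symmetric difference of these circuits is \<open>M \<oplus> S\<close>, where \<open>S\<close>
  consists of at most \<open>a\<close> of these sums and is again Eulerian; hence
  \<open>c2 M \<le> a + c2 S\<close> (lemma \<open>ex_small_residual\<close>). Since every circuit has at least three elements,
  decomposing \<open>S\<close> into disjoint circuits gives \<open>c2 S \<le> a / 3\<close> (lemma \<open>c2_le_third_card\<close>), which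
  is the bound \<open>4 / 3\<close>.

  For large \<open>a\<close> one does better on \<open>S\<close>: any \<open>2 ^ k\<close> vectors contain \<open>k\<close> independent ones, because
  \<open>j\<close> vectors span only \<open>2 ^ j\<close>. A circuit through \<open>k + 1\<close> independent elements of \<open>S\<close> removes
  these and adds at most one vector, so the size drops by \<open>k\<close>; repeating this until fewer than
  \<open>2 ^ (k + 1)\<close> vectors are left yields \<open>c2 S \<le> a / k + 2 ^ (k + 1)\<close> (lemma \<open>c2_le_card_div\<close>).

  For the lower bound, delete one element from each of the \<open>t = c2 M\<close> circuits of an optimal odd
  cover. What remains is covered by \<open>t\<close> independent sets, and the at most \<open>t\<close> deleted vectors
  are, by the same greedy choice, covered by \<open>t / k + 2 ^ k\<close> further ones
  (lemma \<open>arboricity_le_card_div\<close>). In both directions \<open>k\<close> is arbitrary, so the error is \<open>o(a)\<close>.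
\<close>

abbreviation nonzero_vectors :: "nat \<Rightarrow> (nat \<Rightarrow> bit) set" where
  "nonzero_vectors n \<equiv> F2_space n - {0}"

section \<open>Sums over the two-element field\<close>

lemma F2_add_self [simp]: "x + x = (0 :: nat \<Rightarrow> bit)"
  by (simp add: fun_eq_iff)

lemma F2_add_eq_0_iff: "x + y = 0 \<longleftrightarrow> x = (y :: nat \<Rightarrow> bit)"
  by (metis F2_add_self add.assoc add_0 add.right_neutral)

lemma finite_nonzero_vectors: "A \<subseteq> nonzero_vectors n \<Longrightarrow> finite A"
  by (meson Diff_subset finite_F2_space finite_subset)

lemma sum_in_F2_space: "A \<subseteq> F2_space n \<Longrightarrow> \<Sum>A \<in> F2_space n"
proof -
  assume "A \<subseteq> F2_space n"
  moreover from this have "finite A"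
    using finite_F2_space finite_subset by blast
  ultimately show ?thesis
    by (induction A rule: infinite_finite_induct) (auto simp: F2_space_def)
qed

lemma sym_diff_subset: "A \<subseteq> V \<Longrightarrow> B \<subseteq> V \<Longrightarrow> sym_diff A B \<subseteq> V"
  by blast

lemma sum_sym_diff:
  fixes A B :: "(nat \<Rightarrow> bit) set"
  assumes "finite A" "finite B"
  shows "\<Sum>(sym_diff A B) = \<Sum>A + \<Sum>B"
proof -
  have A: "\<Sum>A = \<Sum>(A - B) + \<Sum>(A \<inter> B)"
    using sum.Int_Diff[OF assms(1), of _ B] by (simp only: add.commute)
  have B: "\<Sum>B = \<Sum>(B - A) + \<Sum>(A \<inter> B)"
    using sum.Int_Diff[OF assms(2), of _ A] by (simp only: add.commute Int_commute)
  have "\<Sum>(sym_diff A B) = \<Sum>(A - B) + \<Sum>(B - A)"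
    using assms by (intro sum.union_disjoint) auto
  moreover have "(p + r) + (q + r) = p + q" for p q r :: "nat \<Rightarrow> bit"
    by (simp add: fun_eq_iff algebra_simps)
  ultimately show ?thesis
    using A B by simp
qed

lemma eulerian_sym_diff:
  "finite A \<Longrightarrow> finite B \<Longrightarrow> eulerian A \<Longrightarrow> eulerian B \<Longrightarrow> eulerian (sym_diff A B)"
  unfolding eulerian_def by (simp only: sum_sym_diff) simp

lemma sum_F2_scale_eq_sum_support:
  assumes "finite A"
  shows "(\<Sum>v\<in>A. F2_scale (u v) v) = \<Sum>{v \<in> A. u v = 1}"
proof -
  have "F2_scale (u v) v = (if u v = 1 then v else 0)" for v
    by (cases "u v") (auto simp: F2_scale_def fun_eq_iff)
  then show ?thesis
    using assms by (simp add: sum.inter_filter)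
qed

text \<open>Over the two-element field a coefficient vector is the same thing as its support, so linear
  dependence becomes a statement about subsets.\<close>

lemma independent_iff_no_eulerian_subset:
  assumes "finite A"
  shows "F2.independent A \<longleftrightarrow> (\<forall>D\<subseteq>A. D \<noteq> {} \<longrightarrow> \<not> eulerian D)"
proof -
  have "F2.dependent A \<longleftrightarrow> (\<exists>D\<subseteq>A. D \<noteq> {} \<and> eulerian D)"
  proof
    assume "F2.dependent A"
    then obtain u v where uv: "v \<in> A" "u v \<noteq> 0" "(\<Sum>v\<in>A. F2_scale (u v) v) = 0"
      using F2.dependent_finite[OF assms] by auto
    then have "v \<in> {v \<in> A. u v = 1}" "eulerian {v \<in> A. u v = 1}"
      using assms by (auto simp: eulerian_def sum_F2_scale_eq_sum_support)
    then show "\<exists>D\<subseteq>A. D \<noteq> {} \<and> eulerian D"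
      by (intro exI[of _ "{v \<in> A. u v = 1}"]) auto
  next
    assume "\<exists>D\<subseteq>A. D \<noteq> {} \<and> eulerian D"
    then obtain D v where D: "D \<subseteq> A" "v \<in> D" "eulerian D"
      by auto
    let ?u = "\<lambda>v. if v \<in> D then 1 else 0 :: bit"
    have "{v \<in> A. ?u v = 1} = D"
      using D by auto
    then have "(\<Sum>v\<in>A. F2_scale (?u v) v) = 0"
      using D assms by (simp add: sum_F2_scale_eq_sum_support eulerian_def)
    moreover have "\<exists>v\<in>A. ?u v \<noteq> 0"
      using D by auto
    ultimately show "F2.dependent A"
      unfolding F2.dependent_finite[OF assms] by (intro exI[of _ ?u] conjI)
  qed
  then show ?thesis
    by blast
qed

lemma card_span_le:
  assumes "finite B"
  shows "finite (F2.span B)" "card (F2.span B) \<le> 2 ^ card B"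
proof -
  have *: "F2.span B \<subseteq> Sum ` Pow B"
    using assms by (auto simp: F2.span_finite sum_F2_scale_eq_sum_support)
  have fin: "finite (Sum ` Pow B)"
    using assms by simp
  show "finite (F2.span B)"
    using * fin by (rule finite_subset)
  have "card (F2.span B) \<le> card (Sum ` Pow B)"
    using fin * by (rule card_mono)
  also have "\<dots> \<le> 2 ^ card B"
    using assms by (metis card_Pow card_image_le finite_Pow_iff)
  finally show "card (F2.span B) \<le> 2 ^ card B" .
qed

text \<open>A maximal independent subset \<open>B\<close> of \<open>T\<close> spans \<open>T\<close>, and its span has only \<open>2 ^ card B\<close>
  elements.\<close>

lemma ex_independent_subset_of_card:
  assumes "finite T" "2 ^ k \<le> card T"
  obtains I where "I \<subseteq> T" "F2.independent I" "card I = k"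
proof -
  obtain B where B: "B \<subseteq> T" "F2.independent B" "T \<subseteq> F2.span B"
    using F2.maximal_independent_subset by blast
  have fin: "finite B"
    using B(1) assms(1) finite_subset by blast
  have "card T \<le> 2 ^ card B"
    using card_span_le[OF fin] B(3) card_mono order_trans by blast
  then have "(2::nat) ^ k \<le> 2 ^ card B"
    using assms(2) by linarith
  then have "k \<le> card B"
    by simp
  then obtain I where I: "I \<subseteq> B" "card I = k"
    using obtain_subset_with_card_n[of k B] by blast
  then show ?thesis
    using that[of I] B(1) F2.independent_mono[OF B(2) I(1)] by simp
qed

section \<open>Circuits and independent sets\<close>

text \<open>A vanishing sub-sum must use the new vector, because \<open>I\<close> is independent; its complement in
  \<open>I\<close> then sums to zero as well and is therefore empty.\<close>

lemma circuit_insert_sum: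
  assumes I: "I \<subseteq> nonzero_vectors n" "F2.independent I" "2 \<le> card I"
  shows "\<Sum>I \<notin> I" "circuit n (insert (\<Sum>I) I)"
proof -
  let ?s = "\<Sum>I"
  have fin: "finite I"
    using I(1) by (rule finite_nonzero_vectors)
  have indep: "D = {}" if "D \<subseteq> I" "\<Sum>D = 0" for D
    using independent_iff_no_eulerian_subset[OF fin] I(2) that unfolding eulerian_def by blast
  show notin: "?s \<notin> I"
  proof
    assume s: "?s \<in> I"
    then have "?s = ?s + \<Sum>(I - {?s})"
      by (rule sum.remove[OF fin])
    then have "\<Sum>(I - {?s}) = 0"
      by (metis add_cancel_left_right)
    then have "I - {?s} = {}"
      by (intro indep) auto
    then have "card I \<le> card {?s}"
      by (intro card_mono) auto
    then show False
      using I(3) by simp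
  qed
  have "I \<noteq> {}"
    using I(3) by auto
  then have "?s \<noteq> 0"
    using indep by blast
  moreover have "?s \<in> F2_space n"
    using I(1) by (intro sum_in_F2_space) auto
  ultimately have "insert ?s I \<subseteq> nonzero_vectors n"
    using I(1) by auto
  moreover have "eulerian (insert ?s I)"
    using fin notin by (simp add: eulerian_def)
  moreover have "D = insert ?s I"
    if D: "D \<subseteq> insert ?s I" "D \<noteq> {}" "eulerian D" for D
  proof -
    have finD: "finite D"
      using D(1) fin finite_subset by blast
    have s: "?s \<in> D"
      using indep D unfolding eulerian_def by blast
    have sub: "D - {?s} \<subseteq> I"
      using D(1) by auto
    have "?s + \<Sum>(D - {?s}) = 0"
      using D(3) sum.remove[OF finD s, of "\<lambda>x. x"] unfolding eulerian_def by simp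
    then have "\<Sum>(D - {?s}) = ?s"
      by (simp add: F2_add_eq_0_iff)
    moreover have "?s = \<Sum>(I - (D - {?s})) + \<Sum>(D - {?s})"
      using sub fin by (rule sum.subset_diff)
    ultimately have "\<Sum>(I - (D - {?s})) = 0"
      by (metis add_cancel_right_left)
    then have "I - (D - {?s}) = {}"
      by (intro indep) auto
    then show ?thesis
      using s sub by auto
  qed
  ultimately show "circuit n (insert ?s I)"
    unfolding circuit_def by blast
qed

lemma independent_circuit_minus:
  assumes "circuit n C" "x \<in> C"
  shows "F2.independent (C - {x})"
proof -
  have "finite C"
    using assms(1) finite_nonzero_vectors unfolding circuit_def by blast
  moreover have "\<not> eulerian D" if "D \<subseteq> C - {x}" "D \<noteq> {}" for D
    using that assms unfolding circuit_def by blast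
  ultimately show ?thesis
    by (subst independent_iff_no_eulerian_subset) auto
qed

lemma card_circuit_ge_3:
  assumes "circuit n C"
  shows "3 \<le> card C"
proof (rule ccontr)
  have C: "C \<subseteq> nonzero_vectors n" "C \<noteq> {}" "\<Sum>C = 0"
    using assms unfolding circuit_def eulerian_def by auto
  have "card C \<noteq> 0"
    using C finite_nonzero_vectors by auto
  moreover assume "\<not> 3 \<le> card C"
  ultimately consider "card C = 1" | "card C = 2"
    by linarith
  then show False
  proof cases
    case 1
    then obtain x where "C = {x}"
      by (rule card_1_singletonE)
    then show False
      using C by simp
  next
    case 2
    then obtain x y where "C = {x, y}" "x \<noteq> y"
      by (meson card_2_iff)
    then show False
      using C(3) F2_add_eq_0_iff[of x y] by simp
  qed
qed

section \<open>Subadditivity of the circuit cover number\<close>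

lemma c2_le_length: "circuit_odd_cover n M Cs \<Longrightarrow> c2 n M \<le> length Cs"
  unfolding c2_def by (rule Least_le) blast

lemma obtain_minimum_odd_cover:
  assumes "M \<subseteq> nonzero_vectors n" "eulerian M"
  obtains Cs where "circuit_odd_cover n M Cs" "length Cs = c2 n M"
proof -
  obtain Cs where "circuit_odd_cover n M Cs"
    using ex_circuit_odd_cover[OF assms] by blast
  then have "\<exists>t Cs. length Cs = t \<and> circuit_odd_cover n M Cs"
    by blast
  then have "\<exists>Cs. length Cs = c2 n M \<and> circuit_odd_cover n M Cs"
    unfolding c2_def by (rule LeastI_ex)
  then show ?thesis
    using that by blast
qed

lemma foldr_sym_diff_append:
  "foldr sym_diff (xs @ ys) {} = sym_diff (foldr sym_diff xs {}) (foldr sym_diff ys {})"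
  by (induction xs) auto

lemma c2_empty: "c2 n {} = 0"
  using c2_le_length[of n "{}" "[]"] by (simp add: circuit_odd_cover_def)

lemma c2_circuit: "circuit n C \<Longrightarrow> c2 n C \<le> 1"
  using c2_le_length[of n C "[C]"] by (simp add: circuit_odd_cover_def)

lemma c2_sym_diff:
  assumes "A \<subseteq> nonzero_vectors n" "eulerian A" "B \<subseteq> nonzero_vectors n" "eulerian B"
  shows "c2 n (sym_diff A B) \<le> c2 n A + c2 n B"
proof -
  obtain As where As: "circuit_odd_cover n A As" "length As = c2 n A"
    using obtain_minimum_odd_cover assms by blast
  obtain Bs where Bs: "circuit_odd_cover n B Bs" "length Bs = c2 n B"
    using obtain_minimum_odd_cover assms by blast
  have "foldr sym_diff (As @ Bs) {} = sym_diff A B"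
    using As Bs unfolding foldr_sym_diff_append circuit_odd_cover_def by simp
  then have "circuit_odd_cover n (sym_diff A B) (As @ Bs)"
    using As Bs unfolding circuit_odd_cover_def by auto
  then show ?thesis
    using c2_le_length As Bs by fastforce
qed

section \<open>Odd covers of small Eulerian sets\<close>

text \<open>Splitting off circuits one at a time uses up at least three vectors for each of them.\<close>

lemma c2_le_third_card:
  assumes "S \<subseteq> nonzero_vectors n" "eulerian S"
  shows "3 * c2 n S \<le> card S"
proof -
  have "finite S"
    using assms(1) by (rule finite_nonzero_vectors)
  then show ?thesis
    using assms
  proof (induction S rule: finite_psubset_induct)
    case (psubset S)
    show ?case
    proof (cases "S = {}")
      case True
      then show ?thesis
        by (simp add: c2_empty)
    next
      case False
      let ?E = "{D. D \<subseteq> S \<and> D \<noteq> {} \<and> eulerian D}"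
      have "finite ?E" "S \<in> ?E"
        using psubset False by auto
      then obtain C where C: "C \<in> ?E" and min: "\<And>D. D \<in> ?E \<Longrightarrow> D \<subseteq> C \<Longrightarrow> D = C"
        by (metis (no_types, lifting) finite_has_minimal2)
      have circ: "circuit n C"
        unfolding circuit_def using C min psubset.prems by blast
      have finC: "finite C"
        using C psubset.hyps finite_subset by blast
      have diff: "sym_diff S C = S - C" and add: "sym_diff (S - C) C = S"
        using C by auto
      have eul: "eulerian (S - C)"
        using eulerian_sym_diff[of S C] C finC psubset.hyps psubset.prems diff by simp
      have sub: "S - C \<subset> S" "S - C \<subseteq> nonzero_vectors n"
        using C psubset.prems by blast+
      have "c2 n S \<le> c2 n (S - C) + c2 n C"
        using c2_sym_diff[of "S - C" n C] sub eul circ add unfolding circuit_def by simp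
      then have "3 * c2 n S \<le> 3 * c2 n (S - C) + 3"
        using c2_circuit[OF circ] by linarith
      also have "\<dots> \<le> card (S - C) + card C"
        using psubset.IH[OF sub eul] card_circuit_ge_3[OF circ] by linarith
      also have "\<dots> = card S"
        using C finC psubset.hyps card_mono[of S C] by (simp add: card_Diff_subset)
      finally show ?thesis .
    qed
  qed
qed

text \<open>As long as \<open>S\<close> has \<open>2 ^ (k + 1)\<close> elements, one circuit replaces \<open>k + 1\<close> of them by at
  most one new vector; \<open>c2_le_third_card\<close> deals with the rest.\<close>

lemma c2_le_card_div:
  assumes "S \<subseteq> nonzero_vectors n" "eulerian S" "1 \<le> k"
  shows "k * c2 n S \<le> card S + k * 2 ^ (k + 1)"
  using assms(1,2)
proof (induction "card S" arbitrary: S rule: less_induct)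
  case less
  have fin: "finite S"
    using less.prems(1) by (rule finite_nonzero_vectors)
  show ?case
  proof (cases "card S < 2 ^ (k + 1)")
    case True
    then have "c2 n S \<le> 2 ^ (k + 1)"
      using c2_le_third_card[OF less.prems] by linarith
    then show ?thesis
      by (simp add: trans_le_add2)
  next
    case False
    then obtain I where I: "I \<subseteq> S" "F2.independent I" "card I = k + 1"
      using ex_independent_subset_of_card[OF fin] by (metis not_less)
    define s where "s = \<Sum>I"
    define C where "C = insert s I"
    have circ: "circuit n C"
      unfolding C_def s_def using I less.prems(1) assms(3) by (intro circuit_insert_sum(2)) auto
    then have C: "C \<subseteq> nonzero_vectors n" "eulerian C" "finite C"
      using finite_nonzero_vectors unfolding circuit_def by blast+
    let ?S = "sym_diff S C"
    have "?S \<subseteq> insert s (S - I)"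
      using I(1) by (auto simp: C_def)
    then have "card ?S \<le> card (insert s (S - I))"
      using fin by (intro card_mono) auto
    also have "\<dots> \<le> Suc (card (S - I))"
      by (rule card_insert_le_m1) auto
    also have "\<dots> = Suc (card S - (k + 1))"
      using I fin by (metis card_Diff_subset finite_subset)
    finally have card: "card ?S + k \<le> card S"
      using I card_mono[OF fin I(1)] by linarith
    have S: "?S \<subseteq> nonzero_vectors n" "eulerian ?S"
      using less.prems C fin by (simp_all only: sym_diff_subset eulerian_sym_diff)
    have "sym_diff ?S C = S"
      by auto
    then have "c2 n S \<le> c2 n ?S + 1"
      using c2_sym_diff[OF S C(1,2)] c2_circuit[OF circ] by simp
    then have "k * c2 n S \<le> k * (c2 n ?S + 1)"
      by (rule mult_le_mono2)
    also have "\<dots> \<le> card S + k * 2 ^ (k + 1)"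
      using less.hyps[OF _ S] card assms(3) by simp
    finally show ?thesis .
  qed
qed

section \<open>From independent covers to odd covers\<close>

text \<open>The correction \<open>T\<close> is the sum of \<open>I\<close>. If \<open>I\<close> has at most one element, there is no circuit
  to close, and \<open>T = I\<close> leaves nothing to cover.\<close>

lemma independent_near_circuit:
  assumes "I \<subseteq> nonzero_vectors n" "F2.independent I"
  obtains T where "T \<subseteq> nonzero_vectors n" "card T \<le> 1" "eulerian (sym_diff I T)"
    "c2 n (sym_diff I T) \<le> 1"
proof (cases "2 \<le> card I")
  case True
  have circ: "circuit n (insert (\<Sum>I) I)" and "\<Sum>I \<notin> I"
    using circuit_insert_sum assms True by auto
  then have "sym_diff I {\<Sum>I} = insert (\<Sum>I) I"
    by auto
  then show ?thesis
    using that[of "{\<Sum>I}"] circ c2_circuit[OF circ] unfolding circuit_def by auto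
next
  case False
  then show ?thesis
    using that[of I] assms by (simp add: eulerian_def c2_empty)
qed

text \<open>Repeated sums cancel in pairs, which is why the residual set is built by symmetric
  differences.\<close>

lemma ex_residual_of_independent_cover:
  assumes "\<forall>I\<in>set Is. F2.independent I" "\<Union>(set Is) \<subseteq> nonzero_vectors n"
  shows "\<exists>S\<subseteq>nonzero_vectors n. card S \<le> length Is \<and> eulerian (sym_diff (\<Union>(set Is)) S)
    \<and> c2 n (sym_diff (\<Union>(set Is)) S) \<le> length Is"
  using assms
proof (induction Is)
  case Nil
  then show ?case
    by (intro exI[of _ "{}"]) (simp add: eulerian_def c2_empty)
next
  case (Cons I Is)
  let ?M = "\<Union>(set Is)"
  obtain S where S: "S \<subseteq> nonzero_vectors n" "card S \<le> length Is" "eulerian (sym_diff ?M S)"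
      "c2 n (sym_diff ?M S) \<le> length Is"
    using Cons.IH Cons.prems unfolding list.set by blast
  have "F2.independent (I - ?M)"
    using Cons.prems(1) F2.independent_mono by (metis Diff_subset list.set_intros(1))
  moreover have sub: "I - ?M \<subseteq> nonzero_vectors n" "?M \<subseteq> nonzero_vectors n"
    using Cons.prems(2) unfolding list.set by blast+
  ultimately obtain T where T: "T \<subseteq> nonzero_vectors n" "card T \<le> 1"
      "eulerian (sym_diff (I - ?M) T)" "c2 n (sym_diff (I - ?M) T) \<le> 1"
    using independent_near_circuit[of "I - ?M" n] by metis
  let ?A = "sym_diff (I - ?M) T" and ?B = "sym_diff ?M S"
  have eq: "sym_diff (\<Union>(set (I # Is))) (sym_diff T S) = sym_diff ?A ?B"
    by auto
  have A: "?A \<subseteq> nonzero_vectors n" and B: "?B \<subseteq> nonzero_vectors n"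
    using sub S(1) T(1) by (simp_all only: sym_diff_subset)
  have "card (sym_diff T S) \<le> card (T \<union> S)"
    using S(1) T(1) finite_nonzero_vectors by (intro card_mono) auto
  also have "\<dots> \<le> length (I # Is)"
    using card_Un_le[of T S] S(2) T(2) by simp
  finally have "card (sym_diff T S) \<le> length (I # Is)" .
  moreover have "eulerian (sym_diff ?A ?B)"
    using finite_nonzero_vectors[OF A] finite_nonzero_vectors[OF B] T(3) S(3)
    by (rule eulerian_sym_diff)
  moreover have "c2 n (sym_diff ?A ?B) \<le> length (I # Is)"
    using c2_sym_diff[OF A T(3) B S(3)] S(4) T(4) by simp
  moreover have "sym_diff T S \<subseteq> nonzero_vectors n"
    using T(1) S(1) by (rule sym_diff_subset)
  ultimately show ?case
    unfolding eq[symmetric] by blast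
qed

lemma obtain_minimum_independent_cover:
  assumes "M \<subseteq> nonzero_vectors n"
  obtains Is where "\<forall>I\<in>set Is. F2.independent I" "\<Union>(set Is) = M" "length Is = arboricity M"
proof -
  obtain Is where "\<forall>I\<in>set Is. F2.independent I" "\<Union>(set Is) = M"
    using ex_independent_cover[OF assms] by blast
  then have "\<exists>t Is. length Is = t \<and> (\<forall>I\<in>set Is. F2.independent I) \<and> \<Union>(set Is) = M"
    by blast
  then have "\<exists>Is. length Is = arboricity M \<and> (\<forall>I\<in>set Is. F2.independent I) \<and> \<Union>(set Is) = M"
    unfolding arboricity_def by (rule LeastI_ex)
  then show ?thesis
    using that by blast
qed

text \<open>Since \<open>M\<close> and \<open>M \<oplus> S\<close> are Eulerian, so is \<open>S\<close>, and covering \<open>M\<close> reduces to covering the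
  much smaller set \<open>S\<close>.\<close>

lemma ex_small_residual:
  assumes "M \<subseteq> nonzero_vectors n" "eulerian M"
  obtains S where "S \<subseteq> nonzero_vectors n" "eulerian S" "card S \<le> arboricity M"
    "c2 n M \<le> arboricity M + c2 n S"
proof -
  obtain Is where Is: "\<forall>I\<in>set Is. F2.independent I" "\<Union>(set Is) = M" "length Is = arboricity M"
    using obtain_minimum_independent_cover[OF assms(1)] by blast
  obtain S where S: "S \<subseteq> nonzero_vectors n" "card S \<le> arboricity M" "eulerian (sym_diff M S)"
      "c2 n (sym_diff M S) \<le> arboricity M"
    using ex_residual_of_independent_cover[of Is n] Is assms(1) by metis
  have sub: "sym_diff M S \<subseteq> nonzero_vectors n"
    using assms(1) S(1) by (rule sym_diff_subset)
  have "sym_diff M (sym_diff M S) = S" and M: "sym_diff (sym_diff M S) S = M"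
    by auto
  then have eul: "eulerian S"
    using eulerian_sym_diff[of M "sym_diff M S"] assms sub S(3) finite_nonzero_vectors by metis
  have "c2 n M \<le> c2 n (sym_diff M S) + c2 n S"
    using c2_sym_diff[OF sub S(3) S(1) eul] M by simp
  then show ?thesis
    using that S eul by simp
qed

section \<open>From odd covers to independent covers\<close>

lemma arboricity_le_length:
  "\<forall>I\<in>set Is. F2.independent I \<Longrightarrow> \<Union>(set Is) = M \<Longrightarrow> arboricity M \<le> length Is"
  unfolding arboricity_def by (rule Least_le) blast

lemma arboricity_independent: "F2.independent I \<Longrightarrow> arboricity I \<le> 1"
  using arboricity_le_length[of "[I]" I] by simp

lemma arboricity_mono:
  assumes "A \<subseteq> B" "B \<subseteq> nonzero_vectors n"
  shows "arboricity A \<le> arboricity B"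
proof -
  obtain Is where Is: "\<forall>I\<in>set Is. F2.independent I" "\<Union>(set Is) = B" "length Is = arboricity B"
    using obtain_minimum_independent_cover[OF assms(2)] by blast
  have "arboricity A \<le> length (map (\<lambda>I. I \<inter> A) Is)"
  proof (rule arboricity_le_length)
    show "\<forall>I\<in>set (map (\<lambda>I. I \<inter> A) Is). F2.independent I"
      using Is(1) F2.independent_mono by (auto intro: F2.independent_mono)
    show "\<Union>(set (map (\<lambda>I. I \<inter> A) Is)) = A"
      using Is(2) assms(1) by auto
  qed
  then show ?thesis
    using Is(3) by simp
qed

lemma arboricity_Un:
  assumes "A \<subseteq> nonzero_vectors n" "B \<subseteq> nonzero_vectors n"
  shows "arboricity (A \<union> B) \<le> arboricity A + arboricity B"
proof -
  obtain Is where Is: "\<forall>I\<in>set Is. F2.independent I" "\<Union>(set Is) = A" "length Is = arboricity A"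
    using obtain_minimum_independent_cover[OF assms(1)] by blast
  obtain Js where Js: "\<forall>I\<in>set Js. F2.independent I" "\<Union>(set Js) = B" "length Js = arboricity B"
    using obtain_minimum_independent_cover[OF assms(2)] by blast
  have "arboricity (A \<union> B) \<le> length (Is @ Js)"
    using Is Js by (intro arboricity_le_length) auto
  then show ?thesis
    using Is Js by simp
qed

lemma arboricity_le_card:
  assumes "T \<subseteq> nonzero_vectors n"
  shows "arboricity T \<le> card T"
proof -
  obtain xs where xs: "set xs = T" "distinct xs"
    using finite_distinct_list finite_nonzero_vectors[OF assms] by blast
  have "arboricity T \<le> length (map (\<lambda>x. {x}) xs)"
    using xs assms by (intro arboricity_le_length) auto
  then show ?thesis
    using xs distinct_card by fastforce
qed

text \<open>Independent sets of size \<open>k\<close> are split off while \<open>2 ^ k\<close> vectors are available; the rest is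
  covered by singletons.\<close>

lemma arboricity_le_card_div:
  assumes "T \<subseteq> nonzero_vectors n" "1 \<le> k"
  shows "k * arboricity T \<le> card T + k * 2 ^ k"
  using assms(1)
proof (induction "card T" arbitrary: T rule: less_induct)
  case less
  have fin: "finite T"
    using less.prems by (rule finite_nonzero_vectors)
  show ?case
  proof (cases "card T < 2 ^ k")
    case True
    then have "arboricity T \<le> 2 ^ k"
      using arboricity_le_card[OF less.prems] by linarith
    then show ?thesis
      by (simp add: trans_le_add2)
  next
    case False
    then obtain I where I: "I \<subseteq> T" "F2.independent I" "card I = k"
      using ex_independent_subset_of_card[OF fin] by (metis not_less)
    have card: "card (T - I) + k = card T"
      using I fin card_mono[OF fin I(1)] by (metis card_Diff_subset finite_subset le_add_diff_inverse2)
    have sub: "T - I \<subseteq> nonzero_vectors n" "I \<subseteq> nonzero_vectors n"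
      using less.prems I(1) by blast+
    have "(T - I) \<union> I = T"
      using I(1) by auto
    then have "arboricity T \<le> arboricity (T - I) + 1"
      using arboricity_Un[OF sub] arboricity_independent[OF I(2)] by simp
    then have "k * arboricity T \<le> k * (arboricity (T - I) + 1)"
      by (rule mult_le_mono2)
    also have "\<dots> \<le> card T + k * 2 ^ k"
      using less.hyps[OF _ sub(1)] card assms(2) by simp
    finally show ?thesis .
  qed
qed

lemma foldr_sym_diff_subset_Union: "foldr sym_diff Cs {} \<subseteq> \<Union>(set Cs)"
  by (induction Cs) auto

text \<open>\<open>T\<close> collects one element of each circuit.\<close>

lemma ex_transversal_of_circuits:
  assumes "\<forall>C\<in>set Cs. circuit n C"
  shows "\<exists>T\<subseteq>nonzero_vectors n. card T \<le> length Cs \<and> arboricity (\<Union>(set Cs) - T) \<le> length Cs"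
  using assms
proof (induction Cs)
  case Nil
  then show ?case
    using arboricity_le_length[of "[]"] by (intro exI[of _ "{}"]) simp
next
  case (Cons C Cs)
  then obtain T where T: "T \<subseteq> nonzero_vectors n" "card T \<le> length Cs"
      "arboricity (\<Union>(set Cs) - T) \<le> length Cs"
    unfolding list.set by blast
  have circ: "circuit n C"
    using Cons.prems by simp
  then obtain x where x: "x \<in> C" "C \<subseteq> nonzero_vectors n"
    unfolding circuit_def by blast
  let ?A = "C - {x}" and ?B = "\<Union>(set Cs) - T"
  have sub: "?A \<subseteq> nonzero_vectors n" "?B \<subseteq> nonzero_vectors n"
    using x(2) Cons.prems unfolding circuit_def list.set by blast+
  have "arboricity (\<Union>(set (C # Cs)) - insert x T) \<le> arboricity (?A \<union> ?B)"
    using sub unfolding list.set by (intro arboricity_mono[of _ _ n]) blast+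
  also have "\<dots> \<le> length (C # Cs)"
    using arboricity_Un[OF sub] arboricity_independent[OF independent_circuit_minus[OF circ x(1)]]
      T(3) by simp
  finally have "arboricity (\<Union>(set (C # Cs)) - insert x T) \<le> length (C # Cs)" .
  moreover have "card (insert x T) \<le> length (C # Cs)"
    using T(2) by (simp add: card_insert_le_m1)
  moreover have "insert x T \<subseteq> nonzero_vectors n"
    using T(1) x by blast
  ultimately show ?case
    by blast
qed

lemma arboricity_le_c2:
  assumes "M \<subseteq> nonzero_vectors n" "eulerian M" "1 \<le> k"
  shows "k * arboricity M \<le> (k + 1) * c2 n M + k * 2 ^ k"
proof -
  obtain Cs where Cs: "circuit_odd_cover n M Cs" "length Cs = c2 n M"
    using obtain_minimum_odd_cover[OF assms(1,2)] by blast
  then obtain T where T: "T \<subseteq> nonzero_vectors n" "card T \<le> c2 n M"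
      "arboricity (\<Union>(set Cs) - T) \<le> c2 n M"
    using ex_transversal_of_circuits[of Cs n] unfolding circuit_odd_cover_def by metis
  have sub: "\<Union>(set Cs) - T \<subseteq> nonzero_vectors n"
    using Cs unfolding circuit_odd_cover_def circuit_def by blast
  have "M \<subseteq> (\<Union>(set Cs) - T) \<union> T"
    using Cs foldr_sym_diff_subset_Union[of Cs] unfolding circuit_odd_cover_def by blast
  then have "arboricity M \<le> arboricity ((\<Union>(set Cs) - T) \<union> T)"
    using sub T(1) by (intro arboricity_mono[of _ _ n]) blast+
  also have "\<dots> \<le> c2 n M + arboricity T"
    using arboricity_Un[OF sub T(1)] T(3) by linarith
  finally have "k * arboricity M \<le> k * (c2 n M + arboricity T)"
    by (rule mult_le_mono2)
  also have "\<dots> \<le> (k + 1) * c2 n M + k * 2 ^ k"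
    using arboricity_le_card_div[OF T(1) assms(3)] T(2) by (simp add: algebra_simps)
  finally show ?thesis .
qed

section \<open>The bounds on the circuit cover number\<close>

lemma c2_le_arboricity_four_thirds:
  assumes "M \<subseteq> nonzero_vectors n" "eulerian M"
  shows "3 * c2 n M \<le> 4 * arboricity M"
proof -
  obtain S where "S \<subseteq> nonzero_vectors n" "eulerian S" "card S \<le> arboricity M"
      "c2 n M \<le> arboricity M + c2 n S"
    using ex_small_residual[OF assms] by blast
  then show ?thesis
    using c2_le_third_card[of S n] by linarith
qed

lemma c2_le_arboricity_asymptotic:
  assumes "M \<subseteq> nonzero_vectors n" "eulerian M" "1 \<le> k"
  shows "k * c2 n M \<le> (k + 1) * arboricity M + k * 2 ^ (k + 1)"
proof -
  obtain S where S: "S \<subseteq> nonzero_vectors n" "eulerian S" "card S \<le> arboricity M"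
      "c2 n M \<le> arboricity M + c2 n S"
    using ex_small_residual[OF assms(1,2)] by blast
  have "k * c2 n M \<le> k * (arboricity M + c2 n S)"
    using S(4) by (rule mult_le_mono2)
  also have "\<dots> \<le> (k + 1) * arboricity M + k * 2 ^ (k + 1)"
    using c2_le_card_div[OF S(1,2) assms(3)] S(3) by (simp add: algebra_simps)
  finally show ?thesis .
qed

theorem theorem1p5:
  shows "(\<forall>n M. binary_matroid n M \<longrightarrow> eulerian M \<longrightarrow>
             real (c2 n M) \<le> 4 / 3 * real (arboricity M)) \<and>
         (\<forall>\<epsilon>::real. \<epsilon> > 0 \<longrightarrow> (\<exists>a\<^sub>0::nat. \<forall>n M. binary_matroid n M \<longrightarrow> eulerian M \<longrightarrow>
             arboricity M \<ge> a\<^sub>0 \<longrightarrow>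
             (1 - \<epsilon>) * real (arboricity M) \<le> real (c2 n M) \<and>
             real (c2 n M) \<le> (1 + \<epsilon>) * real (arboricity M)))"
proof (intro conjI allI impI)
  fix n M
  assume "binary_matroid n M" "eulerian M"
  then have "3 * c2 n M \<le> 4 * arboricity M"
    unfolding binary_matroid_def by (intro c2_le_arboricity_four_thirds) auto
  then have "real (3 * c2 n M) \<le> real (4 * arboricity M)"
    by (rule of_nat_mono)
  then show "real (c2 n M) \<le> 4 / 3 * real (arboricity M)"
    by simp
next
  fix \<epsilon> :: real
  assume "\<epsilon> > 0"
  then obtain k :: nat where k: "2 / \<epsilon> < real k"
    using reals_Archimedean2 by blast
  have "0 < 2 / \<epsilon>"
    using \<open>\<epsilon> > 0\<close> by simp
  with k have k0: "0 < real k" "1 \<le> k"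
    by linarith+
  have k\<epsilon>: "2 \<le> \<epsilon> * k"
    using k \<open>\<epsilon> > 0\<close> by (simp add: field_simps)
  show "\<exists>a\<^sub>0::nat. \<forall>n M. binary_matroid n M \<longrightarrow> eulerian M \<longrightarrow> arboricity M \<ge> a\<^sub>0 \<longrightarrow>
      (1 - \<epsilon>) * real (arboricity M) \<le> real (c2 n M) \<and>
      real (c2 n M) \<le> (1 + \<epsilon>) * real (arboricity M)"
    \<comment> \<open>Above this threshold the additive error \<open>k * 2 ^ (k + 1)\<close> is at most \<open>arboricity M\<close>, so
      that the total relative error is \<open>2 / k \<le> \<epsilon>\<close>.\<close>
  proof (intro exI[of _ "k * 2 ^ (k + 1)"] allI impI conjI)
    fix n M
    assume M: "binary_matroid n M" "eulerian M" "k * 2 ^ (k + 1) \<le> arboricity M"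
    define a where "a = real (arboricity M)"
    define c where "c = real (c2 n M)"
    have sub: "M \<subseteq> nonzero_vectors n"
      using M(1) unfolding binary_matroid_def by blast
    have err: "2 * a \<le> \<epsilon> * k * a"
      using k\<epsilon> by (intro mult_right_mono) (auto simp: a_def)
    have "k * c2 n M \<le> (k + 2) * arboricity M"
      using c2_le_arboricity_asymptotic[OF sub M(2) k0(2)] M(3) by simp
    then have "real (k * c2 n M) \<le> real ((k + 2) * arboricity M)"
      by (rule of_nat_mono)
    then have "k * c \<le> (k + 2) * a"
      by (simp add: a_def c_def algebra_simps)
    also have "\<dots> \<le> k * ((1 + \<epsilon>) * a)"
      using err by (simp add: algebra_simps)
    finally have upper: "c \<le> (1 + \<epsilon>) * a"
      using k0(1) by simp
    have lower: "(1 - \<epsilon>) * a \<le> c"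
    proof (cases "c \<le> a")
      case True
      have "k * 2 ^ k \<le> arboricity M"
        using M(3) by simp
      then have "k * arboricity M \<le> (k + 1) * c2 n M + arboricity M"
        using arboricity_le_c2[OF sub M(2) k0(2)] by linarith
      then have "real (k * arboricity M) \<le> real ((k + 1) * c2 n M + arboricity M)"
        by (rule of_nat_mono)
      then have "k * a \<le> k * c + c + a"
        by (simp add: a_def c_def algebra_simps)
      then have "k * ((1 - \<epsilon>) * a) \<le> k * c"
        using err True by (simp add: algebra_simps)
      then show ?thesis
        using k0(1) by simp
    next
      case False
      have "(1 - \<epsilon>) * a \<le> 1 * a"
        using \<open>\<epsilon> > 0\<close> by (intro mult_right_mono) (auto simp: a_def)
      then show ?thesis
        using False by linarith
    qed
    show "(1 - \<epsilon>) * real (arboricity M) \<le> real (c2 n M)"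
      using lower by (simp add: a_def c_def)
    show "real (c2 n M) \<le> (1 + \<epsilon>) * real (arboricity M)"
      using upper by (simp add: a_def c_def)
  qed
qed

end
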